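(* Consider a multi-agent network of $n$ agents with directed interaction graph $\mathcal{G}$, and let the agent states $x_1(t),\dots,x_n(t)\in\mathbb{R}$ be generated by the sampled-data-based algorithm described in the context, with pre-specified time $T_c>0$. Then the equality constraint $$\sum_{i=1}^n x_i(t)=\sum_{i=1}^n x_i(0)=C,\qquad \forall t\in[0,T_c],$$ is always satisfied.
   Context: Graph notation. $\mathcal{G}=(\mathcal{V},\mathcal{E})$ is a directed graph with node (agent) set $\mathcal{V}=\{1,\dots,n\}$ and edge set $\mathcal{E}\subseteq\mathcal{V}\times\mathcal{V}$; $(i,j)\in\mathcal{E}$ means that node $j$ can receive information from node $i$. The adjacency matrix $\mathcal{A}=[a_{ij}]\in\mathbb{R}^{n\times n}$ has $a_{ii}=0$ and, for $i\neq j$, $a_{ij}=1$ if $(j,i)\in\mathcal{E}$ and $a_{ij}=0$ otherwise. The in-degree of agent $i$ is $d_i^{\mathrm{in}}=\sum_{j=1}^n a_{ij}$ and its out-degree is $d_i^{\mathrm{out}}=\sum_{j=1}^n a_{ji}$. Setting. Agent $i$ has state $x_i(t)\in\mathbb{R}$ with initial value $x_i(0)$, and a local objective function $f_i(x_i)$ with derivative $\frac{df_i}{dx_i}$. The number $C$ is a given real scalar with $\sum_{i=1}^n x_i(0)=C$. The overall goal is to minimize $\sum_{i=1}^n f_i(x_i)$ at the pre-specified time $T_c$ while keeping the sum of the states equal to $C$. Algorithm. For all $k\in\mathbb{N}=\{0,1,2,\dots\}$, $t\in[t_k,t_{k+1})$, $i=1,\dots,n$ and $m=1,\dots,n$: $$x_i(t)=x_i(0)-d_i^{\mathrm{out}}\xi_i(t_k)+\sum_{j=1}^n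 a_{ij}\xi_j(t_k),$$ $$\dot\xi_i(t)=\frac{\beta}{t_{k+1}-t_k}\Big(d_i^{\mathrm{out}}\psi_{ii}(t_k)-\sum_{j=1}^n a_{ji}\psi_{ij}(t_k)\Big),$$ $$\dot\psi_{im}(t)=-\frac{1}{(t_{k+1}-t_k)(d_i^{\mathrm{in}}+a_{im})}\Big(\sum_{j=1}^n a_{ij}\big(\psi_{im}(t_k)-\psi_{jm}(t_k)\big)+a_{im}\big(\psi_{im}(t_k)-\tfrac{df_m}{dx_m}(x_m(t_k))\big)\Big).$$ Here $\xi_i$ is an auxiliary variable of agent $i$, $\psi_{im}$ is agent $i$'s estimate of $\frac{df_m(x_m)}{dx_m}$, $\beta$ is a small positive constant, $\xi_i(0)=0$ and $\psi_{im}(0)=0$. The $k$-th sampling instant is $t_k=\sum_{l=1}^k T_l$ for $k\ge 1$ and $t_0=0$, where $T_k=\frac{6}{(\pi k)^2}T_c$ for $k\ge 1$.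
   Formalization: The algorithm defines the states only for t < T_c, since every t_k < T_c; equality is proved on [0,T_c), and at t = T_c under the added assumption that each x_i(T_c) is the left limit of x_i. *)

theory Defs
  imports "HOL-Analysis.Analysis"
begin

text \<open>Agents are the numbers \<open>1, ..., n\<close>; an edge \<open>(i, j)\<close> means that \<open>j\<close> receives information
  from \<open>i\<close>, so row \<open>i\<close> of the adjacency matrix lists the agents that \<open>i\<close> listens to.\<close>

definition adj :: "(nat \<times> nat) set \<Rightarrow> nat \<Rightarrow> nat \<Rightarrow> real" where
  "adj E i j = (if i \<noteq> j \<and> (j, i) \<in> E then 1 else 0)"

definition in_deg :: "nat \<Rightarrow> (nat \<times> nat) set \<Rightarrow> nat \<Rightarrow> real" where
  "in_deg n E i = (\<Sum>j=1..n. adj E i j)"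

definition out_deg :: "nat \<Rightarrow> (nat \<times> nat) set \<Rightarrow> nat \<Rightarrow> real" where
  "out_deg n E i = (\<Sum>j=1..n. adj E j i)"

definition period :: "real \<Rightarrow> nat \<Rightarrow> real" where
  "period Tc k = 6 / (pi * real k)^2 * Tc"

definition sampling_instant :: "real \<Rightarrow> nat \<Rightarrow> real" where
  "sampling_instant Tc k = (\<Sum>l=1..k. period Tc l)"

text \<open>The sampling instants increase to \<open>Tc\<close> without reaching it, so the algorithm determines the
  signals on \<open>[0, Tc)\<close> only; a value \<open>x i Tc\<close> has a meaning as the left limit of \<open>x i\<close> at \<open>Tc\<close>,
  which is not part of this definition because it need not exist. The differential
  equations are understood in the usual sense for
  sampled data: the auxiliary variables are continuous on \<open>[0, Tc)\<close>, and at a sampling instant the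
  derivative within \<open>[t\<^sub>k, t\<^sub>k\<^sub>+\<^sub>1)\<close> is the right derivative. If \<open>in_deg n E i + adj E i m = 0\<close>, then all
  \<open>adj E i j\<close> and \<open>adj E i m\<close> vanish; the right-hand side for \<open>\<psi> i m\<close> is then \<open>0\<close>.\<close>

definition generated_by_algorithm ::
  "nat \<Rightarrow> (nat \<times> nat) set \<Rightarrow> (nat \<Rightarrow> real \<Rightarrow> real) \<Rightarrow> real \<Rightarrow> real \<Rightarrow>
   (nat \<Rightarrow> real \<Rightarrow> real) \<Rightarrow> (nat \<Rightarrow> real \<Rightarrow> real) \<Rightarrow> (nat \<Rightarrow> nat \<Rightarrow> real \<Rightarrow> real) \<Rightarrow> bool" where
  "generated_by_algorithm n E f \<beta> Tc x \<xi> \<psi> \<longleftrightarrow>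
    (\<forall>i\<in>{1..n}. \<xi> i 0 = 0 \<and> continuous_on {0..<Tc} (\<xi> i)) \<and>
    (\<forall>i\<in>{1..n}. \<forall>m\<in>{1..n}. \<psi> i m 0 = 0 \<and> continuous_on {0..<Tc} (\<psi> i m)) \<and>
    (\<forall>k. let s = sampling_instant Tc k; s' = sampling_instant Tc (Suc k) in
      \<forall>t\<in>{s..<s'}. \<forall>i\<in>{1..n}.
        x i t = x i 0 - out_deg n E i * \<xi> i s + (\<Sum>j=1..n. adj E i j * \<xi> j s) \<and>
        (\<xi> i has_real_derivative
          \<beta> / (s' - s) * (out_deg n E i * \<psi> i i s - (\<Sum>j=1..n. adj E j i * \<psi> i j s)))
          (at t within {s..<s'}) \<and>
        (\<forall>m\<in>{1..n}.
          (\<psi> i m has_real_derivative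
            - (1 / ((s' - s) * (in_deg n E i + adj E i m))) *
              ((\<Sum>j=1..n. adj E i j * (\<psi> i m s - \<psi> j m s))
                + adj E i m * (\<psi> i m s - deriv (f m) (x m s))))
            (at t within {s..<s'})))"

end

theory Submission
  imports Defs
begin

text \<open>Summing the state equation over all agents, \<open>d\<^sub>i\<^sup>o\<^sup>u\<^sup>t \<xi>\<^sub>i\<close> cancels against the \<open>a\<^sub>j\<^sub>i \<xi>\<^sub>i\<close> received by
  the other agents, whatever the values of the auxiliary variables. By
  Euler's formula \<open>\<Sum> 1/k\<^sup>2 = \<pi>\<^sup>2/6\<close>, the sampling instants tend to \<open>Tc\<close>, so the sampling intervals
  cover \<open>[0, Tc)\<close>; the value at \<open>Tc\<close> follows by continuity.\<close>

text \<open>Exchanging the sums on the right collects, for each sender, the column sum of the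
  adjacency matrix, which is its out-degree.\<close>

lemma sum_out_deg_mult:
  "(\<Sum>i=1..n. out_deg n E i * z i) = (\<Sum>i=1..n. \<Sum>j=1..n. adj E i j * z j)"
  unfolding out_deg_def sum_distrib_right by (rule sum.swap)

lemma sampling_instant_tendsto: "sampling_instant Tc \<longlonglongrightarrow> Tc"
proof -
  \<comment> \<open>Euler's series indexed from 0: term \<open>k\<close> belongs to period
    \<open>Suc k\<close>, and the factor scales the total to \<open>Tc\<close>.\<close>
  have "(\<lambda>k. 6 * Tc / pi\<^sup>2 * (1 / (real k + 1)\<^sup>2)) sums (6 * Tc / pi\<^sup>2 * (pi\<^sup>2 / 6))"
    by (intro sums_mult) (use inverse_squares_sums in \<open>simp add: add.commute\<close>)
  moreover have "6 * Tc / pi\<^sup>2 * (1 / (real k + 1)\<^sup>2) = period Tc (Suc k)" for k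
    by (simp add: period_def power_mult_distrib add.commute)
  ultimately have "(\<lambda>k. period Tc (Suc k)) sums Tc"
    by simp
  moreover have "(\<Sum>l<k. period Tc (Suc l)) = sampling_instant Tc k" for k
    by (induction k) (simp_all add: sampling_instant_def)
  ultimately show ?thesis
    by (simp add: sums_def)
qed

lemma sampling_interval_exists:
  assumes "0 \<le> t" "t < Tc"
  obtains k where "t \<in> {sampling_instant Tc k..<sampling_instant Tc (Suc k)}"
proof -
  define P where "P k \<longleftrightarrow> t < sampling_instant Tc k" for k
  have "\<exists>k. P k"
    using order_tendstoD(1)[OF sampling_instant_tendsto \<open>t < Tc\<close>]
    unfolding P_def eventually_sequentially by blast
  moreover have "\<not> P 0"
    using \<open>0 \<le> t\<close> by (simp add: P_def sampling_instant_def)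
  \<comment> \<open>The first index satisfying \<open>P\<close> is positive, so it has the form
    \<open>Suc k\<close>, and \<open>P\<close> fails at \<open>k\<close>.\<close>
  ultimately obtain k where "\<not> P k" "P (Suc k)"
    using exists_least_lemma[of P] by blast
  then show ?thesis
    using that[of k] by (simp add: P_def not_less)
qed

lemma sum_states_constant:
  assumes gen: "generated_by_algorithm n E f \<beta> Tc x \<xi> \<psi>" and t: "0 \<le> t" "t < Tc"
  shows "(\<Sum>i=1..n. x i t) = (\<Sum>i=1..n. x i 0)"
proof -
  obtain k where k: "t \<in> {sampling_instant Tc k..<sampling_instant Tc (Suc k)}"
    using sampling_interval_exists[OF t] .
  \<comment> \<open>Throughout the interval the states see \<open>\<xi>\<close> only through its
    sample at the left end, so one vector \<open>z\<close> serves all agents.\<close>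
  define z where "z j = \<xi> j (sampling_instant Tc k)" for j
  have "x i t = x i 0 - out_deg n E i * z i + (\<Sum>j=1..n. adj E i j * z j)" if "i \<in> {1..n}" for i
    using gen[unfolded generated_by_algorithm_def Let_def, THEN conjunct2, THEN conjunct2,
        rule_format, OF k that, THEN conjunct1]
    unfolding z_def .
  then have "(\<Sum>i=1..n. x i t) =
      (\<Sum>i=1..n. x i 0 - out_deg n E i * z i + (\<Sum>j=1..n. adj E i j * z j))"
    by (rule sum.cong[OF refl])
  then show ?thesis
    unfolding sum.distrib sum_subtractf sum_out_deg_mult by simp
qed

theorem lemma2:
  fixes n :: nat and E :: "(nat \<times> nat) set"
    and f x \<xi> :: "nat \<Rightarrow> real \<Rightarrow> real" and \<psi> :: "nat \<Rightarrow> nat \<Rightarrow> real \<Rightarrow> real"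
    and \<beta> Tc C :: real
  assumes "n \<ge> 1"
    and "E \<subseteq> {1..n} \<times> {1..n}"
    and "\<And>i z. i \<in> {1..n} \<Longrightarrow> f i differentiable (at z)"
    and "\<beta> > 0"
    and "Tc > 0"
    and "(\<Sum>i=1..n. x i 0) = C"
    and "generated_by_algorithm n E f \<beta> Tc x \<xi> \<psi>"
  shows "(\<forall>t\<in>{0..<Tc}. (\<Sum>i=1..n. x i t) = (\<Sum>i=1..n. x i 0) \<and> (\<Sum>i=1..n. x i 0) = C) \<and>
    ((\<forall>i\<in>{1..n}. (x i \<longlongrightarrow> x i Tc) (at_left Tc)) \<longrightarrow>
      (\<forall>t\<in>{0..Tc}. (\<Sum>i=1..n. x i t) = (\<Sum>i=1..n. x i 0) \<and> (\<Sum>i=1..n. x i 0) = C))"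
proof -
  have before: "(\<Sum>i=1..n. x i t) = (\<Sum>i=1..n. x i 0)" if "t \<in> {0..<Tc}" for t
    by (rule sum_states_constant[OF assms(7)]) (use that in simp_all)
  have at_Tc: "(\<Sum>i=1..n. x i Tc) = (\<Sum>i=1..n. x i 0)"
    if "\<forall>i\<in>{1..n}. (x i \<longlongrightarrow> x i Tc) (at_left Tc)"
  \<comment> \<open>Two left limits of the summed states at \<open>Tc\<close> are compared: one from
    the assumed left continuity of each state, one from the sum being constant on
    \<open>{0<..<Tc}\<close>.\<close>
  proof (rule tendsto_unique[OF trivial_limit_at_left_real])
    show "((\<lambda>t. \<Sum>i=1..n. x i t) \<longlongrightarrow> (\<Sum>i=1..n. x i Tc)) (at_left Tc)"
      using that by (intro tendsto_sum) blast
    have "\<forall>\<^sub>F t in at_left Tc. (\<Sum>i=1..n. x i t) = (\<Sum>i=1..n. x i 0)"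
      using eventually_at_left_real[OF \<open>Tc > 0\<close>]
      by (rule eventually_mono) (rule before, simp)
    then show "((\<lambda>t. \<Sum>i=1..n. x i t) \<longlongrightarrow> (\<Sum>i=1..n. x i 0)) (at_left Tc)"
      by (rule tendsto_eventually)
  qed
  have "(\<Sum>i=1..n. x i t) = (\<Sum>i=1..n. x i 0)"
    if "\<forall>i\<in>{1..n}. (x i \<longlongrightarrow> x i Tc) (at_left Tc)" "t \<in> {0..Tc}" for t
  proof (cases "t = Tc")
    case True
    then show ?thesis by (simp only: at_Tc[OF that(1)])
  next
    case False
    with that(2) show ?thesis by (intro before) simp
  qed
  then show ?thesis
    using before assms(6) by blast
qed

end
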